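(* Let $Q>0$, let $Z=(Z,d,\mu)$ be an Ahlfors $Q$-regular compact metric measure space with $\operatorname{diam}(Z)=1$, and let $X=(V,E)$ be a hyperbolic filling of $Z$, used to define $\dot A^p(Z)$. Let $p>1$ and $\alpha=Q/p$. Then $\dot M^{\alpha,p}(Z)\subset\dot A^p(Z)$. Moreover, there exists a constant $C\ge0$ such that $$\|f\|_{\dot A^p}\le C\|f\|_{\dot M^{\alpha,p}}$$ for all $f\in\dot M^{\alpha,p}(Z)$.
   Context: Ahlfors regularity: a metric space $(Z,d)$ with a Borel measure $\mu$ is Ahlfors $Q$-regular (with $\operatorname{diam}(Z)=1$) if there is a constant $c\ge 1$ with $c^{-1}r^Q\le\mu(B)\le c\,r^Q$ for every open ball $B$ of radius $0<r\le 1$. Write $|A|=\mu(A)$. Hyperbolic filling: for each $n\in\mathbb{N}=\{1,2,\dots\}$ choose a maximal $2^{-n}$-separated set $Z_n\subset Z$. Let $V_n$ be the collection of balls $B(z,2^{1-n})$, $z\in Z_n$ (level $n$), and $V_0=\{Z\}$ (level $0$). The vertex set $V$ is the disjoint union of the $V_n$, $n\ge 0$. Two distinct vertices $B,B'$ are joined by an (unoriented, unique) edge if their levels differ by at most $1$ and $B\cap B'\ne\emptyset$; $E$ is the set of edges. For each edge $e$ one fixes a choice of initial vertex $e_-$ and terminal vertex $e_+$ among its two endpoints. For $f\in L^1(Z)$ (real-valued), the Poisson extension $Pf\colon V\to\mathbb{R}$ is $Pf(B)=\frac1{|B|}\int_Bf\,d\mu$; for $u\colon V\to\mathbb{R}$,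 $du(e)=u(e_+)-u(e_-)$, $e\in E$. For a countable set $M$ and $p>1$, $\ell^{p,\infty}(M)$ is the space of all $s\colon M\to\mathbb{R}$ for which there is $C\ge0$ with $\#\{m\in M:|s(m)|>\lambda\}\le (C/\lambda)^p$ for all $\lambda>0$, with norm $\|s\|_{\ell^{p,\infty}}=\sup\{n^{-1+1/p}\sum_{j\in F}|s(j)|: n\in\mathbb{N},\ F\subset M,\ \#F=n\}$. $\dot A^p(Z)$ is the space of all $f\in L^1(Z)$ with $d(Pf)\in\ell^{p,\infty}(E)$, with semi-norm $\|f\|_{\dot A^p}=\|d(Pf)\|_{\ell^{p,\infty}}$. Fractional Hajłasz–Sobolev space: for $\alpha>0$ and $f\in L^1(Z)$, $\mathcal D_\alpha(f)$ is the set of all measurable $g\ge0$ on $Z$ for which there is $N\subset Z$ with $|N|=0$ and $|f(x)-f(y)|\le d(x,y)^\alpha(g(x)+g(y))$ for all $x,y\in Z\setminus N$. For $p\ge1$, $\dot M^{\alpha,p}(Z)$ is the space of all $f\in L^1(Z)$ such that $\mathcal D_\alpha(f)\cap L^p(Z)\neq\emptyset$, with semi-norm $\|f\|_{\dot M^{\alpha,p}}=\inf\{\|g\|_{L^p}:g\in\mathcal D_\alpha(f)\}$. *)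

theory Defs
  imports "HOL-Analysis.Analysis"
begin

text \<open>The space \<open>Z\<close> is the whole type \<open>'a\<close>, with its metric \<open>dist\<close>.\<close>

definition ahlfors_regular :: "real \<Rightarrow> 'a::metric_space measure \<Rightarrow> bool" where
  "ahlfors_regular Q \<mu> \<longleftrightarrow>
     sets \<mu> = sets borel \<and>
     (\<exists>c\<ge>1. \<forall>x r. 0 < r \<and> r \<le> 1 \<longrightarrow>
        ennreal (r powr Q / c) \<le> emeasure \<mu> (ball x r) \<and>
        emeasure \<mu> (ball x r) \<le> ennreal (c * r powr Q))"

definition separated_set :: "real \<Rightarrow> 'a::metric_space set \<Rightarrow> bool" where
  "separated_set \<delta> A \<longleftrightarrow> (\<forall>x\<in>A. \<forall>y\<in>A. x \<noteq> y \<longrightarrow> \<delta> \<le> dist x y)"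

definition maximal_separated :: "real \<Rightarrow> 'a::metric_space set \<Rightarrow> bool" where
  "maximal_separated \<delta> A \<longleftrightarrow>
     separated_set \<delta> A \<and> (\<forall>B. A \<subseteq> B \<and> separated_set \<delta> B \<longrightarrow> B = A)"

definition filling_level :: "(nat \<Rightarrow> 'a::metric_space set) \<Rightarrow> nat \<Rightarrow> 'a set set" where
  "filling_level Zs n =
     (if n = 0 then {UNIV} else (\<lambda>z. ball z (2 powi (1 - int n))) ` Zs n)"

text \<open>The disjoint union of the levels: a vertex is a pair of a level and a ball of that level,
  so that a set which occurs as a ball in several levels gives one vertex for each of them.\<close>

type_synonym 'a vertex = "nat \<times> 'a set"

definition filling_vertices :: "(nat \<Rightarrow> 'a::metric_space set) \<Rightarrow> 'a vertex set" where
  "filling_vertices Zs = Sigma UNIV (filling_level Zs)"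

definition filling_edges :: "'a vertex set \<Rightarrow> 'a vertex set set" where
  "filling_edges V =
     {{v, w} | v w. v \<in> V \<and> w \<in> V \<and> v \<noteq> w \<and>
        \<bar>int (fst v) - int (fst w)\<bar> \<le> 1 \<and> snd v \<inter> snd w \<noteq> {}}"

definition hyperbolic_filling :: "'a::metric_space vertex set \<Rightarrow> 'a vertex set set \<Rightarrow> bool" where
  "hyperbolic_filling V E \<longleftrightarrow>
     (\<exists>Zs. (\<forall>n\<ge>1. maximal_separated (2 powi (- int n)) (Zs n)) \<and>
        V = filling_vertices Zs \<and> E = filling_edges V)"

text \<open>A choice of the endpoints \<open>e\<^sub>-\<close> (\<open>ini e\<close>) and \<open>e\<^sub>+\<close> (\<open>ter e\<close>) of every edge \<open>e\<close>.\<close>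

definition edge_orientation :: "'v set set \<Rightarrow> ('v set \<Rightarrow> 'v) \<Rightarrow> ('v set \<Rightarrow> 'v) \<Rightarrow> bool" where
  "edge_orientation E ini ter \<longleftrightarrow> (\<forall>e\<in>E. e = {ini e, ter e})"

definition poisson_extension ::
    "'a::metric_space measure \<Rightarrow> ('a \<Rightarrow> real) \<Rightarrow> 'a vertex \<Rightarrow> real" where
  "poisson_extension \<mu> f v = (1 / measure \<mu> (snd v)) * (LINT x:snd v|\<mu>. f x)"

definition edge_diff ::
    "('v set \<Rightarrow> 'v) \<Rightarrow> ('v set \<Rightarrow> 'v) \<Rightarrow> ('v \<Rightarrow> real) \<Rightarrow> 'v set \<Rightarrow> real" where
  "edge_diff ini ter u e = u (ter e) - u (ini e)"

text \<open>Only the values of \<open>s\<close> on \<open>M\<close> matter. The finiteness requirement is part of the bound on the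
  number of elements, because \<^const>\<open>card\<close> is \<open>0\<close> on infinite sets.\<close>

definition weak_lp :: "real \<Rightarrow> 'm set \<Rightarrow> ('m \<Rightarrow> real) set" where
  "weak_lp p M =
     {s. \<exists>C\<ge>0. \<forall>t>0. finite {m \<in> M. \<bar>s m\<bar> > t} \<and>
           real (card {m \<in> M. \<bar>s m\<bar> > t}) \<le> (C / t) powr p}"

definition weak_lp_norm :: "real \<Rightarrow> 'm set \<Rightarrow> ('m \<Rightarrow> real) \<Rightarrow> ennreal" where
  "weak_lp_norm p M s =
     (SUP F\<in>{F. F \<subseteq> M \<and> finite F \<and> F \<noteq> {}}.
        ennreal (real (card F) powr (- 1 + 1 / p) * (\<Sum>j\<in>F. \<bar>s j\<bar>)))"

definition A_space ::
    "'a::metric_space measure \<Rightarrow> 'a vertex set set \<Rightarrow> ('a vertex set \<Rightarrow> 'a vertex) \<Rightarrow>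
     ('a vertex set \<Rightarrow> 'a vertex) \<Rightarrow> real \<Rightarrow> ('a \<Rightarrow> real) set" where
  "A_space \<mu> E ini ter p =
     {f. integrable \<mu> f \<and> edge_diff ini ter (poisson_extension \<mu> f) \<in> weak_lp p E}"

definition A_seminorm ::
    "'a::metric_space measure \<Rightarrow> 'a vertex set set \<Rightarrow> ('a vertex set \<Rightarrow> 'a vertex) \<Rightarrow>
     ('a vertex set \<Rightarrow> 'a vertex) \<Rightarrow> real \<Rightarrow> ('a \<Rightarrow> real) \<Rightarrow> ennreal" where
  "A_seminorm \<mu> E ini ter p f =
     weak_lp_norm p E (edge_diff ini ter (poisson_extension \<mu> f))"

definition hajlasz_gradients ::
    "'a::metric_space measure \<Rightarrow> real \<Rightarrow> ('a \<Rightarrow> real) \<Rightarrow> ('a \<Rightarrow> real) set" where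
  "hajlasz_gradients \<mu> \<alpha> f =
     {g \<in> borel_measurable \<mu>. (\<forall>x. 0 \<le> g x) \<and>
        (\<exists>N\<in>null_sets \<mu>. \<forall>x\<in>- N. \<forall>y\<in>- N.
           \<bar>f x - f y\<bar> \<le> dist x y powr \<alpha> * (g x + g y))}"

definition Lp_functions :: "'a measure \<Rightarrow> real \<Rightarrow> ('a \<Rightarrow> real) set" where
  "Lp_functions \<mu> p =
     {g \<in> borel_measurable \<mu>. integrable \<mu> (\<lambda>x. \<bar>g x\<bar> powr p)}"

definition Lp_norm :: "'a measure \<Rightarrow> real \<Rightarrow> ('a \<Rightarrow> real) \<Rightarrow> ennreal" where
  "Lp_norm \<mu> p g =
     (if g \<in> Lp_functions \<mu> p
      then ennreal ((LINT x|\<mu>. \<bar>g x\<bar> powr p) powr (1 / p)) else \<infinity>)"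

definition hajlasz_space :: "'a::metric_space measure \<Rightarrow> real \<Rightarrow> real \<Rightarrow> ('a \<Rightarrow> real) set" where
  "hajlasz_space \<mu> \<alpha> p =
     {f. integrable \<mu> f \<and> hajlasz_gradients \<mu> \<alpha> f \<inter> Lp_functions \<mu> p \<noteq> {}}"

definition hajlasz_seminorm ::
    "'a::metric_space measure \<Rightarrow> real \<Rightarrow> real \<Rightarrow> ('a \<Rightarrow> real) \<Rightarrow> ennreal" where
  "hajlasz_seminorm \<mu> \<alpha> p f = (INF g\<in>hajlasz_gradients \<mu> \<alpha> f. Lp_norm \<mu> p g)"

end

theory Submission
  imports Defs
begin

text \<open>
  Let \<open>g\<close> be a Hajlasz gradient of \<open>f\<close> in \<open>L\<^sup>p\<close>, and let a vertex of level \<open>n\<close> have scale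
  \<open>r = 2\<^sup>-\<^sup>n\<close>. Averaging the pointwise inequality over the two balls of an edge bounds the discrete
  gradient on that edge by a constant times the sum of \<open>r\<^sup>\<alpha> Pg(v)\<close> over its two endpoints \<open>v\<close>
  (\<open>edge_diff_le\<close>). It remains to bound the sum of these quantities over \<open>N\<close> edges by a constant
  times \<open>N\<^bsup>1 - 1/p\<^esup>\<close> times the \<open>L\<^sup>p\<close> norm of \<open>g\<close>.

  For this, fix \<open>\<tau> > 0\<close> and cut \<open>g\<close>, separately for each scale, at the height \<open>\<tau> r\<^bsup>-\<alpha>\<^esup>\<close>. The low part
  contributes at most \<open>\<tau>\<close> for each endpoint, \<open>2N\<tau>\<close> in all. For the high part, Ahlfors regularity turns the
  averages into integrals, \<open>r\<^sup>\<alpha> / |B| \<le> C r\<^bsup>\<alpha>-Q\<^esup>\<close>, and makes the degrees of the filling and the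
  overlap of the balls of one level bounded. Hence the high parts contribute at most a constant times
  the integral of \<open>g(x) \<Sum>\<^sub>n 2\<^bsup>n(Q-\<alpha>)\<^esup>\<close>, where \<open>n\<close> runs over the levels with
  \<open>2\<^bsup>n\<alpha>\<^esup> < g(x) / \<tau>\<close>. As \<open>Q > \<alpha>\<close>, this is a geometric series dominated by its largest term, hence by
  \<open>(g(x)/\<tau>)\<^bsup>(Q-\<alpha>)/\<alpha>\<^esup>\<close>, and the exponent is \<open>p - 1\<close> exactly because \<open>\<alpha> = Q/p\<close>.
  So the high parts contribute at most a constant times \<open>\<tau>\<^bsup>1-p\<^esup> \<integral> g\<^sup>p\<close>
  (\<open>high_parts_total\<close>, \<open>edge_sum_le\<close>). The choice \<open>\<tau> = \<parallel>g\<parallel> N\<^bsup>-1/p\<^esup>\<close> balances the two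
  contributions (\<open>weak_lp_norm_le_if_threshold_bound\<close>).
\<close>

section \<open>Measures of balls and packing\<close>

text \<open>The two-sided bound in the form used below: the lower one up to radius 2, which is the radius of
  the root of the filling when the whole space is seen as a ball, and the upper one for all radii.\<close>

locale regular_measure = finite_measure \<mu>
  for \<mu> :: "'a::metric_space measure" +
  fixes Q c M :: real
  assumes sets_eq: "sets \<mu> = sets borel"
    and Q_pos: "Q > 0" and c_pos: "c > 0"
    and ball_lower: "0 < r \<Longrightarrow> r \<le> 2 \<Longrightarrow> c * r powr Q \<le> measure \<mu> (ball x r)"
    and ball_upper: "0 < r \<Longrightarrow> measure \<mu> (ball x r) \<le> M * r powr Q"

text \<open>Compactness covers the space by finitely many unit balls, so that the total mass is finite
  and serves as the upper bound for balls of radius above 1. A ball of radius at most 2 contains the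
  concentric ball of half the radius, which gives the lower bound.\<close>

lemma ahlfors_regular_imp_regular_measure:
  fixes \<mu> :: "'a::metric_space measure"
  assumes "Q > 0" "compact (UNIV :: 'a set)" "ahlfors_regular Q \<mu>"
  shows "\<exists>c M. regular_measure \<mu> Q c M"
proof -
  obtain c where c: "c \<ge> 1" and sets: "sets \<mu> = sets borel"
    and low: "\<And>x r. 0 < r \<Longrightarrow> r \<le> 1 \<Longrightarrow> ennreal (r powr Q / c) \<le> emeasure \<mu> (ball x r)"
    and up: "\<And>x r. 0 < r \<Longrightarrow> r \<le> 1 \<Longrightarrow> emeasure \<mu> (ball x r) \<le> ennreal (c * r powr Q)"
    using assms(3) unfolding ahlfors_regular_def by blast
  have space: "space \<mu> = UNIV"
    using sets sets_eq_imp_space_eq by fastforce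
  have ball_sets: "ball x r \<in> sets \<mu>" for x r
    unfolding sets by simp
  obtain T :: "'a set" where T: "finite T" "UNIV = (\<Union>x\<in>T. ball x 1)"
  proof (rule compactE_image[OF assms(2)])
    show "open (ball x 1)" for x :: 'a by simp
    show "UNIV \<subseteq> (\<Union>x\<in>(UNIV::'a set). ball x 1)" by auto
  qed auto
  have "emeasure \<mu> (space \<mu>) \<le> (\<Sum>x\<in>T. emeasure \<mu> (ball x 1))"
    unfolding space T(2) using T(1) ball_sets by (intro emeasure_subadditive_finite) auto
  also have "\<dots> \<le> (\<Sum>x\<in>T. ennreal c)"
    using up[of 1] by (intro sum_mono) simp
  also have "\<dots> < \<infinity>"
    by (simp add: ennreal_mult_less_top of_nat_less_top)
  finally have fin: "emeasure \<mu> (space \<mu>) \<noteq> \<infinity>" by simp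
  interpret finite_measure \<mu> using fin by (rule finite_measureI)
  have low': "r powr Q / c \<le> measure \<mu> (ball x r)" if "0 < r" "r \<le> 1" for x r
    using low[OF that, of x] by (simp add: emeasure_eq_measure)
  have up': "measure \<mu> (ball x r) \<le> c * r powr Q" if "0 < r" "r \<le> 1" for x r
    using up[OF that, of x] c by (simp add: emeasure_eq_measure)
  define M where "M = max c (measure \<mu> UNIV)"
  have "regular_measure \<mu> Q ((1/2) powr Q / c) M"
  proof
    show "sets \<mu> = sets borel" "Q > 0" "(1/2) powr Q / c > 0" using sets assms(1) c by auto
    show "(1/2) powr Q / c * r powr Q \<le> measure \<mu> (ball x r)" if "0 < r" "r \<le> 2" for r x
    proof -
      have "(1/2) powr Q / c * r powr Q = (r/2) powr Q / c"
        using that by (simp add: powr_divide)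
      also have "\<dots> \<le> measure \<mu> (ball x (r/2))" using that by (intro low') auto
      also have "\<dots> \<le> measure \<mu> (ball x r)"
        using that ball_sets by (intro finite_measure_mono) auto
      finally show ?thesis .
    qed
    show "measure \<mu> (ball x r) \<le> M * r powr Q" if "0 < r" for r x
    proof (cases "r \<le> 1")
      case True
      have "c * r powr Q \<le> M * r powr Q" by (intro mult_right_mono) (auto simp: M_def)
      then show ?thesis using up'[OF that True, of x] by linarith
    next
      case False
      have "measure \<mu> (ball x r) \<le> M"
        using bounded_measure[of "ball x r"] by (simp add: M_def space)
      also have "M * 1 \<le> M * r powr Q"
        using False c assms(1) by (intro mult_left_mono ge_one_powr_ge_zero) (auto simp: M_def)
      finally show ?thesis by simp
    qed
  qed
  then show ?thesis by blast
qed

context regular_measure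
begin

lemma ball_sets [simp]: "ball x r \<in> sets \<mu>"
  unfolding sets_eq by simp

text \<open>Volume counting: the balls of radius \<open>\<delta>/2\<close> about the points of a \<open>\<delta>\<close>-separated set are
  disjoint, and if the points lie in a ball of radius \<open>R\<delta>\<close>, these balls lie in one of radius
  \<open>(R + 1)\<delta>\<close>. The resulting number depends on \<open>R\<close> but not on \<open>\<delta>\<close>.\<close>

lemma card_separated_le:
  fixes A :: "'a set" and R \<delta> :: real
  assumes "separated_set \<delta> A" "0 < \<delta>" "\<delta> \<le> 1" "0 \<le> R"
  shows "finite (A \<inter> ball x (R * \<delta>)) \<and>
    card (A \<inter> ball x (R * \<delta>)) \<le> nat \<lfloor>M * (2 * (R + 1)) powr Q / c\<rfloor>"
proof (rule finite_if_finite_subsets_card_bdd)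
  fix S assume S: "S \<subseteq> A \<inter> ball x (R * \<delta>)" "finite S"
  have disj: "disjoint_family_on (\<lambda>z. ball z (\<delta>/2)) S"
    unfolding disjoint_family_on_def
  proof (intro ballI impI)
    fix y z assume yz: "y \<in> S" "z \<in> S" "y \<noteq> z"
    then have "\<delta> \<le> dist y z" using assms(1) S by (auto simp: separated_set_def)
    then show "ball y (\<delta>/2) \<inter> ball z (\<delta>/2) = {}"
      by (intro disjoint_ballI) simp
  qed
  have "real (card S) * (c * (\<delta>/2) powr Q) = (\<Sum>z\<in>S. c * (\<delta>/2) powr Q)" by simp
  also have "\<dots> \<le> (\<Sum>z\<in>S. measure \<mu> (ball z (\<delta>/2)))"
    using assms by (intro sum_mono ball_lower) auto
  also have "\<dots> = measure \<mu> (\<Union>z\<in>S. ball z (\<delta>/2))"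
    using S disj by (intro finite_measure_finite_Union[symmetric]) auto
  also have "\<dots> \<le> measure \<mu> (ball x ((R + 1) * \<delta>))"
  proof (rule finite_measure_mono)
    have "dist x w < (R + 1) * \<delta>" if "z \<in> S" "dist z w < \<delta>/2" for z w
    proof -
      have "dist x z < R * \<delta>" using that S by auto
      then show ?thesis
        using that assms(2) dist_triangle[of x w z] by (simp add: algebra_simps)
    qed
    then show "(\<Union>z\<in>S. ball z (\<delta>/2)) \<subseteq> ball x ((R + 1) * \<delta>)" by auto
  qed simp
  also have "\<dots> \<le> M * ((R + 1) * \<delta>) powr Q" using assms by (intro ball_upper) auto
  also have "(R + 1) * \<delta> = (2 * (R + 1)) * (\<delta>/2)" by simp
  also have "\<dots> powr Q = (2 * (R + 1)) powr Q * (\<delta>/2) powr Q"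
    using assms by (intro powr_mult) 
  finally have "(real (card S) * c) * (\<delta>/2) powr Q \<le> (M * (2 * (R + 1)) powr Q) * (\<delta>/2) powr Q"
    by (simp add: mult_ac)
  then have "real (card S) * c \<le> M * (2 * (R + 1)) powr Q"
    using assms by simp
  then have "real (card S) \<le> M * (2 * (R + 1)) powr Q / c"
    using c_pos by (simp add: field_simps)
  then show "card S \<le> nat \<lfloor>M * (2 * (R + 1)) powr Q / c\<rfloor>"
    by (simp add: le_nat_floor)
qed

section \<open>Oscillation of averages\<close>

lemma integrable_imp_set_integrable:
  fixes f :: "'a \<Rightarrow> real"
  assumes "integrable \<mu> f" "A \<in> sets \<mu>"
  shows "set_integrable \<mu> A f"
  unfolding set_integrable_def by (rule integrable_mult_indicator[OF assms(2,1)])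

text \<open>Averaging the pointwise bound over \<open>A\<close>. Used twice, with \<open>b\<close> first a value and then an average
  of \<open>g\<close>, it bounds the double average over \<open>A \<times> B\<close>.\<close>

lemma poisson_extension_diff_le:
  assumes f: "integrable \<mu> f" and g: "integrable \<mu> g"
    and A: "A \<in> sets \<mu>" "measure \<mu> A > 0"
    and bound: "AE x in \<mu>. x \<in> A \<longrightarrow> \<bar>f x - a\<bar> \<le> K * (g x + b)"
  shows "\<bar>poisson_extension \<mu> f (n, A) - a\<bar> \<le> K * (poisson_extension \<mu> g (n, A) + b)"
proof -
  note [simp] = integrable_imp_set_integrable[OF f A(1)] integrable_imp_set_integrable[OF g A(1)]
  have const [simp]: "set_integrable \<mu> A (\<lambda>_. k)" for k :: real
    by (intro integrable_imp_set_integrable A) simp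
  have int_const: "(LINT x:A|\<mu>. k) = k * measure \<mu> A" for k :: real
    using A by (simp add: set_lebesgue_integral_def mult.commute)
  have *: "(LINT x:A|\<mu>. K * (g x + b)) = K * ((LINT x:A|\<mu>. g x) + b * measure \<mu> A)"
    by (simp add: set_integral_add int_const)
  have "\<bar>(LINT x:A|\<mu>. f x) - a * measure \<mu> A\<bar> = \<bar>LINT x:A|\<mu>. f x - a\<bar>"
    by (simp add: set_integral_diff int_const)
  also have "\<dots> \<le> (LINT x:A|\<mu>. \<bar>f x - a\<bar>)"
    using set_integral_norm_bound[of \<mu> A "\<lambda>x. f x - a"] by (simp add: set_integral_diff)
  also have "\<dots> \<le> (LINT x:A|\<mu>. K * (g x + b))"
    by (intro set_integral_mono_AE set_integrable_abs set_integrable_mult_right set_integral_diff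
        set_integral_add) (use bound in auto)
  finally have "\<bar>(LINT x:A|\<mu>. f x) - a * measure \<mu> A\<bar> / measure \<mu> A
      \<le> K * ((LINT x:A|\<mu>. g x) + b * measure \<mu> A) / measure \<mu> A"
    unfolding * using A by (intro divide_right_mono) auto
  moreover have "\<bar>(LINT x:A|\<mu>. f x) - a * measure \<mu> A\<bar> / measure \<mu> A
      = \<bar>poisson_extension \<mu> f (n, A) - a\<bar>"
  proof -
    have "poisson_extension \<mu> f (n, A) - a = ((LINT x:A|\<mu>. f x) - a * measure \<mu> A) / measure \<mu> A"
      using A by (simp add: poisson_extension_def field_simps)
    then show ?thesis using A by simp
  qed
  moreover have "K * ((LINT x:A|\<mu>. g x) + b * measure \<mu> A) / measure \<mu> A
      = K * (poisson_extension \<mu> g (n, A) + b)"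
    using A by (simp add: poisson_extension_def field_simps)
  ultimately show ?thesis by simp
qed

lemma poisson_extension_oscillation:
  assumes f: "integrable \<mu> f" and g: "integrable \<mu> g" and h: "g \<in> hajlasz_gradients \<mu> \<alpha> f"
    and A: "A \<in> sets \<mu>" "measure \<mu> A > 0" and B: "B \<in> sets \<mu>" "measure \<mu> B > 0"
    and d: "\<And>x y. x \<in> A \<Longrightarrow> y \<in> B \<Longrightarrow> dist x y \<le> d" and \<alpha>: "\<alpha> \<ge> 0"
  shows "\<bar>poisson_extension \<mu> f (m, A) - poisson_extension \<mu> f (n, B)\<bar>
    \<le> d powr \<alpha> * (poisson_extension \<mu> g (m, A) + poisson_extension \<mu> g (n, B))"
proof -
  obtain N where N: "N \<in> null_sets \<mu>" and g0: "\<And>x. 0 \<le> g x"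
    and Nb: "\<And>x y. x \<notin> N \<Longrightarrow> y \<notin> N \<Longrightarrow> \<bar>f x - f y\<bar> \<le> dist x y powr \<alpha> * (g x + g y)"
    using h by (auto simp: hajlasz_gradients_def)
  have fb: "\<bar>f x - f y\<bar> \<le> d powr \<alpha> * (g x + g y)" if "x \<in> A" "y \<in> B" "x \<notin> N" "y \<notin> N" for x y
  proof -
    have "dist x y powr \<alpha> * (g x + g y) \<le> d powr \<alpha> * (g x + g y)"
      using d[OF that(1,2)] \<alpha> g0 by (intro mult_right_mono powr_mono2) auto
    with Nb[OF that(3,4)] show ?thesis by linarith
  qed
  note notN = AE_not_in[OF N]
  have "\<bar>f x - poisson_extension \<mu> f (n, B)\<bar> \<le> d powr \<alpha> * (g x + poisson_extension \<mu> g (n, B))"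
    if x: "x \<in> A" "x \<notin> N" for x
  proof -
    have "AE y in \<mu>. y \<in> B \<longrightarrow> \<bar>f y - f x\<bar> \<le> d powr \<alpha> * (g y + g x)"
      using notN by eventually_elim (use fb[OF x(1) _ x(2)] in \<open>auto simp: abs_minus_commute add.commute\<close>)
    from poisson_extension_diff_le[OF f g B this] show ?thesis
      by (simp add: abs_minus_commute add.commute)
  qed
  note pointwise = this
  have "AE x in \<mu>. x \<in> A \<longrightarrow> \<bar>f x - poisson_extension \<mu> f (n, B)\<bar>
      \<le> d powr \<alpha> * (g x + poisson_extension \<mu> g (n, B))"
    using notN by eventually_elim (use pointwise in auto)
  from poisson_extension_diff_le[OF f g A this] show ?thesis .
qed

end

section \<open>Weak Lebesgue sequence spaces\<close>

text \<open>Chebyshev's inequality: if \<open>N\<close> entries exceed \<open>t\<close>, then \<open>Nt \<le> K N\<^bsup>1-1/p\<^esup>\<close>, that is,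
  \<open>N \<le> (K/t)\<^sup>p\<close>.\<close>

lemma weak_lp_if_bounded_norm:
  assumes p: "p > 1" and K: "weak_lp_norm p M s \<le> ennreal K" "K \<ge> 0"
  shows "s \<in> weak_lp p M"
proof -
  have bd: "real (card F) powr (- 1 + 1 / p) * (\<Sum>j\<in>F. \<bar>s j\<bar>) \<le> K"
    if "F \<subseteq> M" "finite F" "F \<noteq> {}" for F
  proof -
    have "ennreal (real (card F) powr (- 1 + 1 / p) * (\<Sum>j\<in>F. \<bar>s j\<bar>)) \<le> weak_lp_norm p M s"
      unfolding weak_lp_norm_def by (rule SUP_upper) (use that in auto)
    also note K(1)
    finally show ?thesis using K(2) by simp
  qed
  have count: "real (card F) \<le> (K / t) powr p"
    if t: "t > 0" and F: "F \<subseteq> {m \<in> M. \<bar>s m\<bar> > t}" "finite F" for F t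
  proof (cases "F = {}")
    case False
    define N where "N = real (card F)"
    have N: "N > 0" using False F by (auto simp: N_def card_gt_0_iff)
    have "N powr (1/p) * t = N powr (- 1 + 1/p) * (N * t)"
      using N powr_add[of N "- 1 + 1/p" 1] by simp
    also have "N * t = (\<Sum>j\<in>F. t)" by (simp add: N_def)
    also have "N powr (- 1 + 1/p) * (\<Sum>j\<in>F. t) \<le> N powr (- 1 + 1/p) * (\<Sum>j\<in>F. \<bar>s j\<bar>)"
      using F by (intro mult_left_mono sum_mono) auto
    also have "\<dots> \<le> K" using bd[of F] F False by (auto simp: N_def)
    finally have "N powr (1/p) \<le> K / t" using t by (simp add: field_simps)
    then have "(N powr (1/p)) powr p \<le> (K / t) powr p"
      using p by (intro powr_mono2) auto
    then show ?thesis using N p by (simp add: powr_powr N_def)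
  qed simp
  have "finite {m \<in> M. \<bar>s m\<bar> > t} \<and> card {m \<in> M. \<bar>s m\<bar> > t} \<le> nat \<lfloor>(K / t) powr p\<rfloor>"
    if "t > 0" for t
    using count[OF that] by (intro finite_if_finite_subsets_card_bdd) (auto intro: le_nat_floor)
  with count show ?thesis
    unfolding weak_lp_def using K(2) by (intro CollectI exI[of _ K]) blast
qed

text \<open>With \<open>N\<close> the number of indices in \<open>F\<close>, the threshold \<open>\<tau> = \<kappa> N\<^bsup>-1/p\<^esup>\<close> makes both terms of the
  bound at most \<open>\<kappa> N\<^bsup>1-1/p\<^esup>\<close>. Here \<open>I\<close> stands for \<open>\<integral> g\<^sup>p\<close>; letting \<open>\<kappa>\<close> be any positive number with
  \<open>I \<le> \<kappa>\<^sup>p\<close> keeps the threshold positive when \<open>g\<close> vanishes almost everywhere.\<close>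

lemma weak_lp_norm_le_if_threshold_bound:
  assumes p: "p > 1" and A: "A \<ge> 0" and \<kappa>: "\<kappa> > 0" and I: "I \<le> \<kappa> powr p"
    and bound: "\<And>F \<tau>. F \<subseteq> M \<Longrightarrow> finite F \<Longrightarrow> \<tau> > 0 \<Longrightarrow>
      (\<Sum>j\<in>F. \<bar>s j\<bar>) \<le> A * (real (card F) * \<tau> + \<tau> powr (1 - p) * I)"
  shows "weak_lp_norm p M s \<le> ennreal (2 * A * \<kappa>)"
  unfolding weak_lp_norm_def
proof (intro SUP_least ennreal_leI)
  fix F assume F: "F \<in> {F. F \<subseteq> M \<and> finite F \<and> F \<noteq> {}}"
  define N where "N = real (card F)"
  have N: "N > 0" using F by (auto simp: N_def card_gt_0_iff)
  define \<tau> where "\<tau> = \<kappa> * N powr (- (1/p))"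
  have \<tau>: "\<tau> > 0" using \<kappa> N by (simp add: \<tau>_def)
  have 1: "N * \<tau> = \<kappa> * N powr (1 - 1/p)"
    using N by (simp add: \<tau>_def powr_diff powr_minus field_simps)
  have "- (1/p) * (1 - p) = 1 - 1/p" using p by (simp add: field_simps)
  then have "\<tau> powr (1 - p) = \<kappa> powr (1 - p) * N powr (1 - 1/p)"
    using \<kappa> N by (simp add: \<tau>_def powr_mult powr_powr)
  then have "\<tau> powr (1 - p) * I \<le> \<kappa> powr (1 - p) * N powr (1 - 1/p) * \<kappa> powr p"
    using I by (simp add: mult_left_mono)
  also have "\<dots> = (\<kappa> powr (1 - p) * \<kappa> powr p) * N powr (1 - 1/p)" by simp
  also have "\<kappa> powr (1 - p) * \<kappa> powr p = \<kappa>"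
    using \<kappa> by (simp flip: powr_add)
  finally have 2: "\<tau> powr (1 - p) * I \<le> \<kappa> * N powr (1 - 1/p)" .
  have "(\<Sum>j\<in>F. \<bar>s j\<bar>) \<le> A * (N * \<tau> + \<tau> powr (1 - p) * I)"
    using bound[of F \<tau>] F \<tau> by (auto simp: N_def)
  also have "\<dots> \<le> A * (\<kappa> * N powr (1 - 1/p) + \<kappa> * N powr (1 - 1/p))"
    using 1 2 A by (intro mult_left_mono add_mono) auto
  finally have "N powr (- 1 + 1/p) * (\<Sum>j\<in>F. \<bar>s j\<bar>) \<le>
      N powr (- 1 + 1/p) * (2 * A * \<kappa> * N powr (1 - 1/p))"
    by (intro mult_left_mono) (auto simp: algebra_simps)
  also have "\<dots> = 2 * A * \<kappa> * (N powr (- 1 + 1/p) * N powr (1 - 1/p))" by simp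
  also have "N powr (- 1 + 1/p) * N powr (1 - 1/p) = 1"
    using N by (simp flip: powr_add)
  finally show "real (card F) powr (- 1 + 1 / p) * (\<Sum>j\<in>F. \<bar>s j\<bar>) \<le> 2 * A * \<kappa>"
    by (simp add: N_def)
qed

section \<open>A geometric series\<close>

text \<open>The terms \<open>2\<^bsup>n\<theta>\<^esup>\<close> grow geometrically, so the sum is controlled by the one with the largest
  index in \<open>I\<close>, for which \<open>2\<^bsup>n\<alpha>\<^esup> < y/\<tau>\<close> still holds.\<close>

lemma geometric_threshold_sum:
  fixes y \<tau> \<alpha> \<theta> :: real
  assumes "\<alpha> > 0" "\<theta> > 0" "\<tau> > 0" "finite I"
    and I: "\<And>n. n \<in> I \<Longrightarrow> \<tau> < ((1/2)^n) powr \<alpha> * y"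
  shows "(\<Sum>n\<in>I. ((1/2)^n) powr (- \<theta>)) \<le> 2 powr \<theta> / (2 powr \<theta> - 1) * (y / \<tau>) powr (\<theta> / \<alpha>)"
proof (cases "I = {}")
  case True
  then show ?thesis using assms ge_one_powr_ge_zero[of 2 \<theta>] by simp
next
  case False
  define q where "q = (2::real) powr \<theta>"
  have q: "q > 1" using assms by (simp add: q_def)
  have term_eq: "((1/2)^n) powr (- \<theta>) = q ^ n" for n :: nat
    by (simp add: q_def powr_minus powr_divide power_divide powr_realpow[symmetric] powr_powr mult.commute
        flip: powr_realpow)
  define m where "m = Max I"
  have m: "m \<in> I" using False assms by (simp add: m_def)
  have "(\<Sum>n\<in>I. q ^ n) \<le> (\<Sum>n<Suc m. q ^ n)"
    using assms q by (intro sum_mono2) (auto simp: m_def less_Suc_eq_le)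
  also have "\<dots> = (q ^ Suc m - 1) / (q - 1)"
    using q by (subst geometric_sum) auto
  also have "\<dots> \<le> q / (q - 1) * q ^ m"
    using q by (simp add: divide_right_mono)
  finally have sum: "(\<Sum>n\<in>I. q ^ n) \<le> q / (q - 1) * q ^ m" .
  have "q ^ m \<le> (y / \<tau>) powr (\<theta> / \<alpha>)"
  proof -
    have pos: "((1/2::real)^m) powr \<alpha> > 0" by simp
    have "((1/2)^m) powr (- \<alpha>) \<le> y / \<tau>"
      using I[OF m] assms(3) pos by (simp add: powr_minus field_simps)
    then have "(((1/2)^m) powr (- \<alpha>)) powr (\<theta> / \<alpha>) \<le> (y / \<tau>) powr (\<theta> / \<alpha>)"
      using assms by (intro powr_mono2) auto
    then show ?thesis using assms by (simp add: powr_powr flip: term_eq)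
  qed
  then have "q / (q - 1) * q ^ m \<le> q / (q - 1) * (y / \<tau>) powr (\<theta> / \<alpha>)"
    using q by (intro mult_left_mono) auto
  with sum show ?thesis by (simp add: term_eq q_def)
qed

section \<open>The geometry of the filling\<close>

text \<open>Level 0 is treated like the others: as the diameter of the space is 1, the whole space is the
  ball of radius \<open>2 = 2 (1/2)\<^sup>0\<close> about any point.\<close>

locale ball_filling = regular_measure \<mu> Q c M
  for \<mu> :: "'a::metric_space measure" and Q c M :: real +
  fixes Zs :: "nat \<Rightarrow> 'a set"
  assumes separated: "separated_set ((1/2) ^ n) (Zs n)"
begin

definition level_balls :: "nat \<Rightarrow> 'a set set" where
  "level_balls n = (\<lambda>z. ball z (2 * (1/2) ^ n)) ` Zs n"

definition vertices :: "'a vertex set" where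
  "vertices = Sigma UNIV level_balls"

text \<open>The packing number for \<open>R = 6\<close>, since the centres of neighbouring balls are less than 6 times
  the scale of either ball apart; the same number bounds the overlap within one level.\<close>

definition multiplicity_bound :: nat where
  "multiplicity_bound = nat \<lfloor>M * (2 * (6 + 1)) powr Q / c\<rfloor>"

lemma near_centres:
  shows finite_near_centres: "finite (Zs n \<inter> ball x (6 * (1/2) ^ n))"
    and card_near_centres_le: "card (Zs n \<inter> ball x (6 * (1/2) ^ n)) \<le> multiplicity_bound"
  using card_separated_le[OF separated, of n 6 x]
  by (auto simp: multiplicity_bound_def power_le_one)

text \<open>Bounded overlap: if \<open>x\<close> lies in a ball of level \<open>n\<close>, then the centre of the ball is near \<open>x\<close>.\<close>

lemma card_level_balls_containing:
  "finite {B \<in> level_balls n. x \<in> B} \<and> card {B \<in> level_balls n. x \<in> B} \<le> multiplicity_bound"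
proof -
  let ?S = "Zs n \<inter> ball x (6 * (1/2) ^ n)"
  have "dist z x < 6 * (1/2) ^ n" if "dist z x < 2 * (1/2) ^ n" for z
    using that by (rule less_le_trans) simp
  then have sub: "{B \<in> level_balls n. x \<in> B} \<subseteq> (\<lambda>z. ball z (2 * (1/2) ^ n)) ` ?S"
    by (auto simp: level_balls_def dist_commute intro!: imageI)
  then have "card {B \<in> level_balls n. x \<in> B} \<le> card ((\<lambda>z. ball z (2 * (1/2) ^ n)) ` ?S)"
    using finite_near_centres by (intro card_mono) auto
  also have "\<dots> \<le> card ?S" by (intro card_image_le finite_near_centres)
  also note card_near_centres_le
  finally show ?thesis using finite_subset[OF sub] finite_near_centres by auto
qed

lemma scale_le_double:
  "\<bar>int m - int n\<bar> \<le> 1 \<Longrightarrow> (1/2 :: real) ^ m \<le> 2 * (1/2) ^ n"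
  using power_decreasing[of n "Suc m" "1/2::real"] by (simp add: mult.commute)

text \<open>Bounded degree: a neighbour belongs to one of three levels, and on each of them its centre \<open>y\<close>
  is at distance less than \<open>2 (1/2)\<^sup>n + 2 (1/2)\<^sup>m \<le> 6 (1/2)\<^sup>m\<close> from the centre of the given ball.\<close>

lemma card_neighbours:
  assumes "v \<in> vertices"
  defines "nbrs \<equiv> {w \<in> vertices. \<bar>int (fst v) - int (fst w)\<bar> \<le> 1 \<and> snd v \<inter> snd w \<noteq> {}}"
  shows "finite nbrs \<and> card nbrs \<le> 3 * multiplicity_bound"
proof -
  obtain n z where v: "v = (n, ball z (2 * (1/2) ^ n))"
    using assms(1) by (auto simp: vertices_def level_balls_def)
  define S where "S m = (\<lambda>y. ball y (2 * (1/2) ^ m)) ` (Zs m \<inter> ball z (6 * (1/2) ^ m))" for m :: nat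
  have finS: "finite (S m)" for m unfolding S_def using finite_near_centres by blast
  have cardS: "card (S m) \<le> multiplicity_bound" for m
    unfolding S_def using card_image_le[OF finite_near_centres] card_near_centres_le by (rule order_trans)
  have sub: "nbrs \<subseteq> Sigma {n - 1..n + 1} S"
  proof
    fix w assume w: "w \<in> nbrs"
    then have "w \<in> vertices" by (simp add: nbrs_def)
    then obtain m y where w_eq: "w = (m, ball y (2 * (1/2) ^ m))" and y: "y \<in> Zs m"
      by (auto simp: vertices_def level_balls_def)
    from w have lev: "\<bar>int n - int m\<bar> \<le> 1" by (simp add: nbrs_def v w_eq)
    from w obtain u where u: "dist z u < 2 * (1/2) ^ n" "dist y u < 2 * (1/2) ^ m"
      by (auto simp: nbrs_def v w_eq)
    have "dist z y < 6 * (1/2) ^ m"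
      using u scale_le_double[OF lev] dist_triangle2[of z y u] by linarith
    then show "w \<in> Sigma {n - 1..n + 1} S"
      using lev y by (auto simp: w_eq S_def intro!: imageI)
  qed
  have fin: "finite (Sigma {n - 1..n + 1} S)" using finS by blast
  have "card nbrs \<le> card (Sigma {n - 1..n + 1} S)" using sub fin by (rule card_mono[rotated])
  also have "\<dots> = (\<Sum>m = n - 1..n + 1. card (S m))" using finS by (simp add: card_SigmaI)
  also have "\<dots> \<le> (\<Sum>m = n - 1..n + 1. multiplicity_bound)" using cardS by (rule sum_mono)
  also have "\<dots> \<le> 3 * multiplicity_bound" by (cases n) auto
  finally show ?thesis using finite_subset[OF sub fin] by simp
qed

lemma card_incident_edges:
  assumes "v \<in> vertices"
  shows "finite {e \<in> filling_edges vertices. v \<in> e} \<and>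
    card {e \<in> filling_edges vertices. v \<in> e} \<le> 3 * multiplicity_bound"
proof -
  let ?N = "{w \<in> vertices. \<bar>int (fst v) - int (fst w)\<bar> \<le> 1 \<and> snd v \<inter> snd w \<noteq> {}}"
  have sub: "{e \<in> filling_edges vertices. v \<in> e} \<subseteq> (\<lambda>w. {v, w}) ` ?N"
  proof
    fix e assume "e \<in> {e \<in> filling_edges vertices. v \<in> e}"
    then have "e \<in> filling_edges vertices" "v \<in> e" by auto
    then obtain a b where ab: "e = {a, b}" "a \<in> vertices" "b \<in> vertices" "v = a \<or> v = b"
      "\<bar>int (fst a) - int (fst b)\<bar> \<le> 1" "snd a \<inter> snd b \<noteq> {}"
      unfolding filling_edges_def by blast
    then have "e = {v, if v = a then b else a}" "(if v = a then b else a) \<in> ?N"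
      by (auto simp: Int_commute abs_minus_commute)
    then show "e \<in> (\<lambda>w. {v, w}) ` ?N" by blast
  qed
  have fin: "finite ?N" and le: "card ?N \<le> 3 * multiplicity_bound"
    using card_neighbours[OF assms] by auto
  have "card {e \<in> filling_edges vertices. v \<in> e} \<le> card ((\<lambda>w. {v, w}) ` ?N)"
    using sub fin by (intro card_mono) auto
  also have "\<dots> \<le> card ?N" using fin by (rule card_image_le)
  finally show ?thesis using le finite_subset[OF sub] fin by auto
qed

lemma measure_vertex_ge:
  assumes "(n, A) \<in> vertices"
  shows "A \<in> sets \<mu>" "c * ((1/2) ^ n) powr Q \<le> measure \<mu> A" "measure \<mu> A > 0"
proof -
  obtain z where A: "A = ball z (2 * (1/2) ^ n)"
    using assms by (auto simp: vertices_def level_balls_def)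
  show "A \<in> sets \<mu>" by (simp add: A)
  have "c * ((1/2) ^ n) powr Q \<le> c * (2 * (1/2) ^ n) powr Q"
    using c_pos Q_pos by (intro mult_left_mono powr_mono2) auto
  also have "\<dots> \<le> measure \<mu> A"
    unfolding A by (intro ball_lower) (auto simp: power_le_one)
  finally show *: "c * ((1/2) ^ n) powr Q \<le> measure \<mu> A" .
  have "0 < c * ((1/2) ^ n) powr Q" using c_pos by simp
  with * show "measure \<mu> A > 0" by linarith
qed

section \<open>Discrete gradient against Hajlasz gradient\<close>

text \<open>The last identity is where the criticality \<open>\<alpha> p = Q\<close> enters the geometric series.\<close>

lemma critical_exponent:
  assumes "\<alpha> = Q / p" "p > 1"
  shows "0 < \<alpha>" "\<alpha> < Q" "(Q - \<alpha>) / \<alpha> = p - 1"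
proof -
  show "0 < \<alpha>" using assms Q_pos by simp
  show "\<alpha> < Q" using assms Q_pos by (simp add: divide_less_eq)
  have "Q / \<alpha> = p" "\<alpha> \<noteq> 0" using assms Q_pos by auto
  then show "(Q - \<alpha>) / \<alpha> = p - 1" by (simp add: diff_divide_distrib)
qed

text \<open>If the balls of the edge have scales \<open>r\<close> and \<open>s\<close>, then two points in the one and the other
  are at most \<open>4r + 4s\<close> apart, and since each scale is at most twice the other,
  this is at most 12 times the smaller one.\<close>

lemma edge_diff_le:
  assumes f: "integrable \<mu> f" and g: "integrable \<mu> g" and h: "g \<in> hajlasz_gradients \<mu> \<alpha> f"
    and \<alpha>: "\<alpha> \<ge> 0" and e: "e \<in> filling_edges vertices"
    and or: "edge_orientation (filling_edges vertices) ini ter"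
  shows "\<bar>edge_diff ini ter (poisson_extension \<mu> f) e\<bar>
    \<le> 12 powr \<alpha> * (\<Sum>v\<in>e. ((1/2) ^ fst v) powr \<alpha> * poisson_extension \<mu> g v)"
proof -
  have g0: "0 \<le> g x" for x using h by (simp add: hajlasz_gradients_def)
  have P0: "0 \<le> poisson_extension \<mu> g v" for v
    using g0 by (simp add: poisson_extension_def set_lebesgue_integral_def)
  obtain n A m B where e_eq: "e = {(n, A), (m, B)}" and ne: "(n, A) \<noteq> (m, B)"
    and V: "(n, A) \<in> vertices" "(m, B) \<in> vertices"
    and lev: "\<bar>int n - int m\<bar> \<le> 1" and meet: "A \<inter> B \<noteq> {}"
  proof -
    obtain v w where "e = {v, w}" "v \<noteq> w" "v \<in> vertices" "w \<in> vertices"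
      "\<bar>int (fst v) - int (fst w)\<bar> \<le> 1" "snd v \<inter> snd w \<noteq> {}"
      using e unfolding filling_edges_def by blast
    then show thesis
      by (cases v; cases w) (rule that, auto)
  qed
  define r s where "r = (1/2 :: real) ^ n" and "s = (1/2 :: real) ^ m"
  have rs: "r > 0" "s > 0" "r \<le> 2 * s" "s \<le> 2 * r"
    using scale_le_double[of n m] scale_le_double[of m n] lev by (auto simp: r_def s_def)
  obtain y z where AB: "A = ball y (2 * r)" "B = ball z (2 * s)"
    using V by (auto simp: vertices_def level_balls_def r_def s_def)
  have d: "dist a b \<le> 12 * min r s" if ab: "a \<in> A" "b \<in> B" for a b
  proof -
    obtain u where u: "u \<in> A" "u \<in> B" using meet by auto
    have "dist a u < 4 * r"
      using ab u dist_triangle3[of a u y] by (auto simp: AB)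
    moreover have "dist u b < 4 * s"
      using ab u dist_triangle3[of u b z] by (auto simp: AB)
    ultimately show ?thesis using dist_triangle[of a b u] rs by linarith
  qed
  have scale: "(12 * min r s) powr \<alpha> \<le> 12 powr \<alpha> * t powr \<alpha>" if "t = r \<or> t = s" for t
  proof -
    have "(12 * min r s) powr \<alpha> \<le> (12 * t) powr \<alpha>"
      using that rs \<alpha> by (intro powr_mono2) auto
    then show ?thesis using that rs by (auto simp: powr_mult)
  qed
  have "e = {ini e, ter e}" using or e by (simp add: edge_orientation_def)
  then have "\<bar>edge_diff ini ter (poisson_extension \<mu> f) e\<bar>
      = \<bar>poisson_extension \<mu> f (n, A) - poisson_extension \<mu> f (m, B)\<bar>"
    unfolding edge_diff_def e_eq by (auto simp: doubleton_eq_iff abs_minus_commute)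
  also have "\<dots> \<le> (12 * min r s) powr \<alpha> *
      (poisson_extension \<mu> g (n, A) + poisson_extension \<mu> g (m, B))"
    using V by (intro poisson_extension_oscillation f g h d \<alpha> measure_vertex_ge)
  also have "\<dots> \<le> (12 powr \<alpha> * r powr \<alpha>) * poisson_extension \<mu> g (n, A)
      + (12 powr \<alpha> * s powr \<alpha>) * poisson_extension \<mu> g (m, B)"
    unfolding distrib_left using scale P0 by (intro add_mono mult_right_mono) auto
  also have "\<dots> = 12 powr \<alpha> * (\<Sum>v\<in>e. ((1/2) ^ fst v) powr \<alpha> * poisson_extension \<mu> g v)"
    using ne by (simp add: e_eq r_def s_def algebra_simps)
  finally show ?thesis .
qed

text \<open>The cut at height \<open>\<tau> r\<^bsup>-\<alpha>\<^esup>\<close> for the scale \<open>r\<close> of level \<open>n\<close>.\<close>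

definition high_part :: "real \<Rightarrow> real \<Rightarrow> ('a \<Rightarrow> real) \<Rightarrow> nat \<Rightarrow> 'a \<Rightarrow> real" where
  "high_part \<alpha> \<tau> g n x = (if \<tau> < ((1/2) ^ n) powr \<alpha> * g x then g x else 0)"

lemma integrable_high_part:
  assumes g: "integrable \<mu> g"
  shows "integrable \<mu> (high_part \<alpha> \<tau> g n)"
proof (rule Bochner_Integration.integrable_bound[OF g])
  have [measurable]: "g \<in> borel_measurable \<mu>" using g by simp
  show "high_part \<alpha> \<tau> g n \<in> borel_measurable \<mu>"
    unfolding high_part_def by measurable
qed (auto simp: high_part_def)

text \<open>Pointwise \<open>r\<^sup>\<alpha> g \<le> \<tau> + r\<^sup>\<alpha> h\<close> for the high part \<open>h\<close>, and the ball of \<open>v\<close> has measure at least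
  \<open>c r\<^sup>Q\<close>.\<close>

lemma scaled_average_le_threshold_plus:
  assumes g: "integrable \<mu> g" and g0: "\<And>x. 0 \<le> g x" and v: "v \<in> vertices" and \<tau>: "\<tau> > 0"
  shows "((1/2) ^ fst v) powr \<alpha> * poisson_extension \<mu> g v
    \<le> \<tau> + ((1/2) ^ fst v) powr (\<alpha> - Q) / c * (LINT x:snd v|\<mu>. high_part \<alpha> \<tau> g (fst v) x)"
proof -
  obtain n A where v_eq: "v = (n, A)" by (cases v)
  note A = measure_vertex_ge[OF v[unfolded v_eq]]
  define r where "r = (1/2 :: real) ^ n"
  have r: "r > 0" by (simp add: r_def)
  define H where "H = (LINT x:A|\<mu>. high_part \<alpha> \<tau> g n x)"
  have H0: "H \<ge> 0"
    unfolding H_def set_lebesgue_integral_def using g0 by (intro integral_nonneg_AE) (auto simp: high_part_def)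
  note [simp] = integrable_imp_set_integrable[OF g A(1)]
    integrable_imp_set_integrable[OF integrable_high_part[OF g] A(1)]
  have const [simp]: "set_integrable \<mu> A (\<lambda>_. k)" for k :: real
    by (intro integrable_imp_set_integrable A) simp
  have "r powr \<alpha> * (LINT x:A|\<mu>. g x) = (LINT x:A|\<mu>. r powr \<alpha> * g x)" by simp
  also have "\<dots> \<le> (LINT x:A|\<mu>. \<tau> + r powr \<alpha> * high_part \<alpha> \<tau> g n x)"
  proof (rule set_integral_mono)
    show "r powr \<alpha> * g x \<le> \<tau> + r powr \<alpha> * high_part \<alpha> \<tau> g n x" for x
      using \<tau> by (simp add: high_part_def r_def)
  qed (simp_all add: set_integral_add)
  also have "\<dots> = \<tau> * measure \<mu> A + r powr \<alpha> * H"
    using A(1) by (simp add: set_integral_add H_def) (simp add: set_lebesgue_integral_def)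
  finally have "r powr \<alpha> * (LINT x:A|\<mu>. g x) / measure \<mu> A
      \<le> (\<tau> * measure \<mu> A + r powr \<alpha> * H) / measure \<mu> A"
    using A(3) by (intro divide_right_mono) auto
  also have "\<dots> = \<tau> + r powr \<alpha> * H / measure \<mu> A"
    using A(3) by (simp add: field_simps)
  also have "r powr \<alpha> * H / measure \<mu> A \<le> r powr \<alpha> * H / (c * r powr Q)"
    using A H0 r c_pos by (intro divide_left_mono mult_pos_pos) (auto simp: r_def)
  also have "\<dots> = r powr (\<alpha> - Q) / c * H"
    using r c_pos by (simp add: powr_diff)
  finally show ?thesis by (simp add: v_eq poisson_extension_def r_def H_def)
qed

definition series_bound :: "real \<Rightarrow> real" where
  "series_bound \<alpha> = multiplicity_bound * (2 powr (Q - \<alpha>) / (2 powr (Q - \<alpha>) - 1))"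

text \<open>A vertex contributes at \<open>x\<close> only if its ball contains \<open>x\<close> and its level satisfies the threshold
  condition at \<open>x\<close>. Each level has boundedly many balls of the first kind, and the levels of the
  second kind give a geometric series.\<close>

lemma high_parts_pointwise:
  assumes W: "finite W" "W \<subseteq> vertices" and \<alpha>: "0 < \<alpha>" "\<alpha> < Q" and g0: "0 \<le> g x" and \<tau>: "\<tau> > 0"
  shows "(\<Sum>v\<in>W. ((1/2) ^ fst v) powr (\<alpha> - Q) * (indicator (snd v) x * high_part \<alpha> \<tau> g (fst v) x))
    \<le> series_bound \<alpha> * (g x / \<tau>) powr ((Q - \<alpha>) / \<alpha>) * g x"
proof -
  let ?D = multiplicity_bound
  define J where "J = {n \<in> fst ` W. \<tau> < ((1/2) ^ n) powr \<alpha> * g x}"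
  define L where "L n = {B \<in> level_balls n. x \<in> B}" for n
  have finJ: "finite J" using W by (simp add: J_def)
  have L: "finite (L n)" "card (L n) \<le> ?D" for n
    using card_level_balls_containing[of n x] by (auto simp: L_def)
  have fin: "finite (Sigma J L)" using finJ L(1) by blast
  have "(\<Sum>v\<in>W. ((1/2) ^ fst v) powr (\<alpha> - Q) * (indicator (snd v) x * high_part \<alpha> \<tau> g (fst v) x))
      = (\<Sum>v\<in>W \<inter> Sigma J L. ((1/2) ^ fst v) powr (\<alpha> - Q) *
          (indicator (snd v) x * high_part \<alpha> \<tau> g (fst v) x))"
  proof (rule sum.mono_neutral_right[OF W(1)])
    have "v \<in> Sigma J L" if "v \<in> W" "x \<in> snd v" "\<tau> < ((1/2) ^ fst v) powr \<alpha> * g x" for v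
    proof -
      have "snd v \<in> level_balls (fst v)" using that W(2) by (auto simp: vertices_def)
      moreover have "fst v \<in> fst ` W" using that by blast
      ultimately show ?thesis using that by (cases v) (simp add: J_def L_def)
    qed
    then show "\<forall>v\<in>W - W \<inter> Sigma J L. ((1/2) ^ fst v) powr (\<alpha> - Q) *
        (indicator (snd v) x * high_part \<alpha> \<tau> g (fst v) x) = 0"
      by (auto simp: high_part_def indicator_def)
  qed auto
  also have "\<dots> \<le> (\<Sum>v\<in>W \<inter> Sigma J L. ((1/2) ^ fst v) powr (\<alpha> - Q) * g x)"
    using g0 by (intro sum_mono mult_left_mono) (auto simp: high_part_def indicator_def)
  also have "\<dots> \<le> (\<Sum>v\<in>Sigma J L. ((1/2) ^ fst v) powr (\<alpha> - Q) * g x)"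
    using fin g0 by (intro sum_mono2) auto
  also have "\<dots> = (\<Sum>n\<in>J. \<Sum>B\<in>L n. ((1/2) ^ n) powr (\<alpha> - Q) * g x)"
    using finJ L(1) by (subst sum.Sigma) (auto simp: case_prod_beta)
  also have "\<dots> \<le> (\<Sum>n\<in>J. ?D * (((1/2) ^ n) powr (\<alpha> - Q) * g x))"
    using L(2) g0 by (auto intro!: sum_mono mult_right_mono)
  also have "\<dots> = ?D * (\<Sum>n\<in>J. ((1/2) ^ n) powr (- (Q - \<alpha>))) * g x"
    by (simp add: sum_distrib_left sum_distrib_right mult.assoc)
  also have "\<dots> \<le> ?D * (2 powr (Q - \<alpha>) / (2 powr (Q - \<alpha>) - 1) * (g x / \<tau>) powr ((Q - \<alpha>) / \<alpha>)) * g x"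
    using \<alpha> \<tau> finJ g0
    by (intro mult_right_mono mult_left_mono geometric_threshold_sum) (auto simp: J_def)
  finally show ?thesis by (simp add: series_bound_def)
qed

lemma high_parts_total:
  assumes W: "finite W" "W \<subseteq> vertices" and \<alpha>: "\<alpha> = Q / p" and p: "p > 1"
    and g: "integrable \<mu> g" and g0: "\<And>x. 0 \<le> g x" and gp: "integrable \<mu> (\<lambda>x. g x powr p)"
    and \<tau>: "\<tau> > 0"
  shows "(\<Sum>v\<in>W. ((1/2) ^ fst v) powr (\<alpha> - Q) * (LINT x:snd v|\<mu>. high_part \<alpha> \<tau> g (fst v) x))
    \<le> series_bound \<alpha> * (\<tau> powr (1 - p) * (LINT x|\<mu>. g x powr p))"
proof -
  have \<alpha>': "0 < \<alpha>" "\<alpha> < Q" "(Q - \<alpha>) / \<alpha> = p - 1"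
    using critical_exponent[OF \<alpha> p] .
  have int: "integrable \<mu> (\<lambda>x. ((1/2) ^ fst v) powr (\<alpha> - Q) *
      (indicator (snd v) x * high_part \<alpha> \<tau> g (fst v) x))" if "v \<in> W" for v
    using integrable_imp_set_integrable[OF integrable_high_part[OF g], of "snd v" \<alpha> \<tau> "fst v"]
      measure_vertex_ge(1)[of "fst v" "snd v"] that W(2)
    by (auto simp: set_integrable_def)
  have "(\<Sum>v\<in>W. ((1/2) ^ fst v) powr (\<alpha> - Q) * (LINT x:snd v|\<mu>. high_part \<alpha> \<tau> g (fst v) x))
      = (LINT x|\<mu>. (\<Sum>v\<in>W. ((1/2) ^ fst v) powr (\<alpha> - Q) *
          (indicator (snd v) x * high_part \<alpha> \<tau> g (fst v) x)))"
    using int by (subst Bochner_Integration.integral_sum) (auto simp: set_lebesgue_integral_def)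
  also have "\<dots> \<le> (LINT x|\<mu>. series_bound \<alpha> * (\<tau> powr (1 - p) * g x powr p))"
  proof (rule integral_mono)
    show "integrable \<mu> (\<lambda>x. \<Sum>v\<in>W. ((1/2) ^ fst v) powr (\<alpha> - Q) *
          (indicator (snd v) x * high_part \<alpha> \<tau> g (fst v) x))"
      using int by (rule Bochner_Integration.integrable_sum)
    show "integrable \<mu> (\<lambda>x. series_bound \<alpha> * (\<tau> powr (1 - p) * g x powr p))"
      using gp by simp
    fix x
    have "(g x / \<tau>) powr (p - 1) * g x = \<tau> powr (1 - p) * g x powr p"
    proof (cases "g x = 0")
      case False
      then have "g x > 0" using g0[of x] by simp
      then show ?thesis using \<tau> by (simp add: powr_divide powr_diff)
    qed (use p in simp)
    then show "(\<Sum>v\<in>W. ((1/2) ^ fst v) powr (\<alpha> - Q) *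
          (indicator (snd v) x * high_part \<alpha> \<tau> g (fst v) x))
        \<le> series_bound \<alpha> * (\<tau> powr (1 - p) * g x powr p)"
      using high_parts_pointwise[of W \<alpha> g x \<tau>, OF W \<alpha>'(1,2) g0 \<tau>] \<alpha>'(3) by (simp add: mult.assoc)
  qed
  also have "\<dots> = series_bound \<alpha> * (\<tau> powr (1 - p) * (LINT x|\<mu>. g x powr p))" by simp
  finally show ?thesis .
qed

definition norm_constant :: "real \<Rightarrow> real" where
  "norm_constant \<alpha> = 12 powr \<alpha> * (2 + 3 * multiplicity_bound * series_bound \<alpha> / c)"

text \<open>The bound for an arbitrary threshold. Bounded degree turns the sum of the high parts over the
  edges and their endpoints into one over the vertices.\<close>

lemma edge_sum_le:
  assumes \<alpha>: "\<alpha> = Q / p" and p: "p > 1"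
    and f: "integrable \<mu> f" and h: "g \<in> hajlasz_gradients \<mu> \<alpha> f"
    and g: "integrable \<mu> g" and gp: "integrable \<mu> (\<lambda>x. g x powr p)"
    and or: "edge_orientation (filling_edges vertices) ini ter"
    and F: "F \<subseteq> filling_edges vertices" "finite F" and \<tau>: "\<tau> > 0"
  shows "(\<Sum>e\<in>F. \<bar>edge_diff ini ter (poisson_extension \<mu> f) e\<bar>)
    \<le> norm_constant \<alpha> * (real (card F) * \<tau> + \<tau> powr (1 - p) * (LINT x|\<mu>. g x powr p))"
proof -
  note \<alpha>' = critical_exponent[OF \<alpha> p]
  have g0: "0 \<le> g x" for x using h by (simp add: hajlasz_gradients_def)
  let ?D = multiplicity_bound
  let ?I = "\<tau> powr (1 - p) * (LINT x|\<mu>. g x powr p)"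
  define b where "b v = ((1/2) ^ fst v) powr (\<alpha> - Q) * (LINT x:snd v|\<mu>. high_part \<alpha> \<tau> g (fst v) x)"
    for v :: "'a vertex"
  have b0: "0 \<le> b v" for v
    unfolding b_def set_lebesgue_integral_def using g0
    by (intro mult_nonneg_nonneg integral_nonneg_AE) (auto simp: high_part_def)
  have S0: "0 \<le> series_bound \<alpha>"
    using \<alpha>' ge_one_powr_ge_zero[of 2 "Q - \<alpha>"] by (simp add: series_bound_def)
  have I0: "0 \<le> ?I" by simp
  define W where "W = \<Union>F"
  have edge: "finite e \<and> card e = 2 \<and> e \<subseteq> vertices" if "e \<in> F" for e
  proof -
    have "e \<in> filling_edges vertices" using that F by blast
    then obtain v w where "e = {v, w}" "v \<noteq> w" "v \<in> vertices" "w \<in> vertices"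
      unfolding filling_edges_def by blast
    then show ?thesis by auto
  qed
  have W: "finite W" "W \<subseteq> vertices" using edge F by (auto simp: W_def)
  have degree: "real (card {e \<in> F. v \<in> e}) \<le> 3 * ?D" if "v \<in> W" for v
  proof -
    have "card {e \<in> F. v \<in> e} \<le> card {e \<in> filling_edges vertices. v \<in> e}"
      using card_incident_edges[of v] that W F by (intro card_mono) auto
    also have "\<dots> \<le> 3 * ?D" using card_incident_edges[of v] that W by auto
    finally have "real (card {e \<in> F. v \<in> e}) \<le> real (3 * ?D)" by (rule of_nat_mono)
    then show ?thesis by simp
  qed
  have "(\<Sum>e\<in>F. \<Sum>v\<in>e. b v) = (\<Sum>e\<in>F. \<Sum>v | v \<in> W \<and> v \<in> e. b v)"
    by (intro sum.cong) (auto simp: W_def)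
  also have "\<dots> = (\<Sum>v\<in>W. \<Sum>e | e \<in> F \<and> v \<in> e. b v)"
    using F W by (intro sum.swap_restrict) auto
  also have "\<dots> = (\<Sum>v\<in>W. real (card {e \<in> F. v \<in> e}) * b v)" by simp
  also have "\<dots> \<le> (\<Sum>v\<in>W. 3 * ?D * b v)"
    using degree b0 by (intro sum_mono mult_right_mono) auto
  also have "\<dots> = 3 * ?D * (\<Sum>v\<in>W. b v)" by (simp add: sum_distrib_left)
  also have "\<dots> \<le> 3 * ?D * (series_bound \<alpha> * ?I)"
    unfolding b_def using high_parts_total[OF W \<alpha> p g g0 gp \<tau>] by (intro mult_left_mono) auto
  finally have high: "(\<Sum>e\<in>F. \<Sum>v\<in>e. b v) \<le> 3 * ?D * (series_bound \<alpha> * ?I)" .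
  have "(\<Sum>e\<in>F. \<bar>edge_diff ini ter (poisson_extension \<mu> f) e\<bar>)
      \<le> (\<Sum>e\<in>F. 12 powr \<alpha> * (\<Sum>v\<in>e. ((1/2) ^ fst v) powr \<alpha> * poisson_extension \<mu> g v))"
    using F \<alpha>' by (intro sum_mono edge_diff_le[OF f g h _ _ or]) auto
  also have "\<dots> = 12 powr \<alpha> * (\<Sum>e\<in>F. \<Sum>v\<in>e. ((1/2) ^ fst v) powr \<alpha> * poisson_extension \<mu> g v)"
    by (simp add: sum_distrib_left)
  also have "\<dots> \<le> 12 powr \<alpha> * (\<Sum>e\<in>F. \<Sum>v\<in>e. \<tau> + b v / c)"
  proof (intro mult_left_mono sum_mono)
    fix e v assume "e \<in> F" "v \<in> e"
    then have "v \<in> vertices" using edge by blast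
    from scaled_average_le_threshold_plus[OF g g0 this \<tau>, of \<alpha>]
    show "((1/2) ^ fst v) powr \<alpha> * poisson_extension \<mu> g v \<le> \<tau> + b v / c"
      by (simp add: b_def)
  qed simp
  also have "(\<Sum>e\<in>F. \<Sum>v\<in>e. \<tau> + b v / c) = 2 * real (card F) * \<tau> + (\<Sum>e\<in>F. \<Sum>v\<in>e. b v) / c"
    using edge by (simp add: sum.distrib sum_divide_distrib)
  also have "\<dots> \<le> 2 * (real (card F) * \<tau>) + 3 * ?D * (series_bound \<alpha> * ?I) / c"
    using high c_pos by (intro add_mono divide_right_mono) auto
  also have "\<dots> \<le> (2 + 3 * ?D * series_bound \<alpha> / c) * (real (card F) * \<tau> + ?I)"
  proof -
    have "0 \<le> 2 * ?I" "0 \<le> (3 * ?D * series_bound \<alpha> / c) * (real (card F) * \<tau>)"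
      using I0 S0 c_pos \<tau> by auto
    then show ?thesis by (simp add: algebra_simps)
  qed
  finally show ?thesis by (simp add: norm_constant_def mult.assoc)
qed

lemma norm_constant_pos: "0 < \<alpha> \<Longrightarrow> \<alpha> < Q \<Longrightarrow> norm_constant \<alpha> > 0"
  using c_pos ge_one_powr_ge_zero[of 2 "Q - \<alpha>"]
  by (auto simp: norm_constant_def series_bound_def intro!: mult_pos_pos add_pos_nonneg)

text \<open>The number \<open>\<kappa>\<close> has to be positive while the \<open>L\<^sup>p\<close> norm of \<open>g\<close> may be 0, so \<open>\<kappa>\<close> is chosen
  slightly larger than the norm, and the excess tends to 0 at the end.\<close>

lemma A_seminorm_le_Lp_norm:
  assumes \<alpha>: "\<alpha> = Q / p" and p: "p > 1" and f: "integrable \<mu> f"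
    and h: "g \<in> hajlasz_gradients \<mu> \<alpha> f"
    and or: "edge_orientation (filling_edges vertices) ini ter"
  shows "A_seminorm \<mu> (filling_edges vertices) ini ter p f
    \<le> ennreal (2 * norm_constant \<alpha>) * Lp_norm \<mu> p g"
proof (cases "g \<in> Lp_functions \<mu> p")
  case False
  have "norm_constant \<alpha> > 0" by (intro norm_constant_pos critical_exponent[OF \<alpha> p])
  then show ?thesis using False by (simp add: Lp_norm_def ennreal_mult_top)
next
  case True
  have A: "norm_constant \<alpha> > 0" by (intro norm_constant_pos critical_exponent[OF \<alpha> p])
  have g0: "0 \<le> g x" for x using h by (simp add: hajlasz_gradients_def)
  have gp: "integrable \<mu> (\<lambda>x. g x powr p)"
    using True g0 by (simp add: Lp_functions_def)
  \<comment> \<open>The measure is finite and \<open>p > 1\<close>, so that \<open>g \<le> 1 + g\<^sup>p\<close> puts \<open>g\<close> into \<open>L\<^sup>1\<close>.\<close>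
  have g: "integrable \<mu> g"
  proof (rule Bochner_Integration.integrable_bound)
    show "integrable \<mu> (\<lambda>x. 1 + g x powr p)" using gp by simp
    show "g \<in> borel_measurable \<mu>" using h by (simp add: hajlasz_gradients_def)
    have "g x \<le> 1 + g x powr p" for x
    proof (cases "g x \<le> 1")
      case False
      then show ?thesis using powr_mono[of 1 p "g x"] p by simp
    qed (simp add: add_increasing2)
    then show "AE x in \<mu>. norm (g x) \<le> norm (1 + g x powr p)"
      using g0 by (intro AE_I2) (simp add: abs_of_nonneg add_nonneg_nonneg)
  qed
  define I where "I = (LINT x|\<mu>. g x powr p)"
  have I0: "I \<ge> 0" by (simp add: I_def)
  have I_eq: "I = (I powr (1/p)) powr p" using I0 p by (simp add: powr_powr)
  have bound: "A_seminorm \<mu> (filling_edges vertices) ini ter p f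
      \<le> ennreal (2 * norm_constant \<alpha> * I powr (1/p)) + ennreal \<epsilon>" if \<epsilon>: "\<epsilon> > 0" for \<epsilon>
  proof -
    define \<kappa> where "\<kappa> = I powr (1/p) + \<epsilon> / (2 * norm_constant \<alpha>)"
    have \<kappa>: "\<kappa> > I powr (1/p)" using \<epsilon> A by (simp add: \<kappa>_def)
    have "I \<le> \<kappa> powr p"
      by (subst I_eq) (use \<kappa> p in \<open>auto intro: powr_mono2\<close>)
    moreover have "\<kappa> > 0" using \<kappa> by (rule le_less_trans[rotated]) simp
    ultimately have "A_seminorm \<mu> (filling_edges vertices) ini ter p f
        \<le> ennreal (2 * norm_constant \<alpha> * \<kappa>)"
      unfolding A_seminorm_def I_def using A edge_sum_le[OF \<alpha> p f h g gp or]
      by (intro weak_lp_norm_le_if_threshold_bound[OF p]) auto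
    also have "2 * norm_constant \<alpha> * \<kappa> = 2 * norm_constant \<alpha> * I powr (1/p) + \<epsilon>"
      using A by (simp add: \<kappa>_def field_simps)
    finally show ?thesis using A \<epsilon> by (simp add: ennreal_plus)
  qed
  have "A_seminorm \<mu> (filling_edges vertices) ini ter p f
      \<le> ennreal (2 * norm_constant \<alpha> * I powr (1/p))"
    by (rule ennreal_le_epsilon) (use bound in auto)
  also have "\<dots> = ennreal (2 * norm_constant \<alpha>) * Lp_norm \<mu> p g"
    using True A g0 by (simp add: Lp_norm_def I_def ennreal_mult)
  finally show ?thesis .
qed

end

lemma hyperbolic_filling_eq_balls:
  fixes V :: "'a::metric_space vertex set"
  assumes "hyperbolic_filling V E" "compact (UNIV :: 'a set)" "diameter (UNIV :: 'a set) = 1"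
  obtains Zs :: "nat \<Rightarrow> 'a set" where "\<And>n. separated_set ((1/2) ^ n) (Zs n)"
    and "V = Sigma UNIV (\<lambda>n. (\<lambda>z. ball z (2 * (1/2) ^ n)) ` Zs n)" and "E = filling_edges V"
proof -
  obtain Zs where Zs: "\<And>n. n \<ge> 1 \<Longrightarrow> maximal_separated (2 powi (- int n)) (Zs n)"
    and V: "V = filling_vertices Zs" and E: "E = filling_edges V"
    using assms(1) by (auto simp: hyperbolic_filling_def)
  have pow: "2 powi (- int n) = (1/2 :: real) ^ n" "2 powi (1 - int n) = 2 * (1/2 :: real) ^ n" for n
    by (simp_all add: power_int_diff power_int_minus power_one_over field_simps)
  \<comment> \<open>Any point can be the centre of the ball of level 0.\<close>
  define Zs' where "Zs' n = (if n = 0 then {undefined} else Zs n)" for n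
  have "dist x y \<le> 1" for x y :: 'a
    using diameter_bounded_bound[OF compact_imp_bounded[OF assms(2)], of x y] assms(3) by simp
  then have "ball x 2 = (UNIV :: 'a set)" for x :: 'a
    by (fastforce intro: le_less_trans)
  then have "filling_level Zs n = (\<lambda>z. ball z (2 * (1/2) ^ n)) ` Zs' n" for n
    by (simp add: filling_level_def Zs'_def pow)
  then have "filling_level Zs = (\<lambda>n. (\<lambda>z. ball z (2 * (1/2) ^ n)) ` Zs' n)" by (rule ext)
  then have "V = Sigma UNIV (\<lambda>n. (\<lambda>z. ball z (2 * (1/2) ^ n)) ` Zs' n)"
    by (simp add: V filling_vertices_def)
  moreover have "separated_set ((1/2) ^ n) (Zs' n)" for n
    using Zs[of n] by (cases "n = 0") (auto simp: Zs'_def maximal_separated_def separated_set_def pow)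
  ultimately show thesis using that E by blast
qed

section \<open>The embedding\<close>

theorem proposition5p3:
  fixes \<mu> :: "'a::metric_space measure" and Q p \<alpha> :: real
    and V :: "'a vertex set" and E :: "'a vertex set set"
    and ini ter :: "'a vertex set \<Rightarrow> 'a vertex"
  assumes "Q > 0"
    and "compact (UNIV :: 'a set)"
    and "diameter (UNIV :: 'a set) = 1"
    and "ahlfors_regular Q \<mu>"
    and "hyperbolic_filling V E"
    and "edge_orientation E ini ter"
    and "p > 1"
    and "\<alpha> = Q / p"
  shows "hajlasz_space \<mu> \<alpha> p \<subseteq> A_space \<mu> E ini ter p \<and>
    (\<exists>C::real. C \<ge> 0 \<and>
       (\<forall>f \<in> hajlasz_space \<mu> \<alpha> p.
          A_seminorm \<mu> E ini ter p f \<le> ennreal C * hajlasz_seminorm \<mu> \<alpha> p f))"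
proof -
  obtain c M where reg: "regular_measure \<mu> Q c M"
    using ahlfors_regular_imp_regular_measure[OF assms(1,2,4)] by blast
  obtain Zs where sep: "\<And>n. separated_set ((1/2) ^ n) (Zs n)"
    and V: "V = Sigma UNIV (\<lambda>n. (\<lambda>z. ball z (2 * (1/2) ^ n)) ` Zs n)" and E: "E = filling_edges V"
    using hyperbolic_filling_eq_balls[OF assms(5,2,3)] by metis
  interpret regular_measure \<mu> Q c M by (rule reg)
  interpret ball_filling \<mu> Q c M Zs by unfold_locales (rule sep)
  have E': "E = filling_edges vertices"
    by (simp add: E V vertices_def level_balls_def[abs_def])
  define C where "C = 2 * norm_constant \<alpha>"
  have C: "C > 0"
    unfolding C_def using norm_constant_pos[OF critical_exponent(1,2)[OF assms(8,7)]] by simp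
  have norm: "A_seminorm \<mu> E ini ter p f \<le> ennreal C * Lp_norm \<mu> p g"
    if "f \<in> hajlasz_space \<mu> \<alpha> p" "g \<in> hajlasz_gradients \<mu> \<alpha> f" for f g
    unfolding E' C_def using that assms(6)
    by (intro A_seminorm_le_Lp_norm assms(7,8)) (auto simp: hajlasz_space_def E')
  have "f \<in> A_space \<mu> E ini ter p" if f: "f \<in> hajlasz_space \<mu> \<alpha> p" for f
  proof -
    obtain g where g: "g \<in> hajlasz_gradients \<mu> \<alpha> f" "g \<in> Lp_functions \<mu> p"
      using f by (auto simp: hajlasz_space_def)
    let ?K = "C * (LINT x|\<mu>. \<bar>g x\<bar> powr p) powr (1 / p)"
    have "weak_lp_norm p E (edge_diff ini ter (poisson_extension \<mu> f)) \<le> ennreal ?K"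
      using norm[OF f g(1)] g(2) C by (simp add: A_seminorm_def Lp_norm_def ennreal_mult)
    then have "edge_diff ini ter (poisson_extension \<mu> f) \<in> weak_lp p E"
      using C by (intro weak_lp_if_bounded_norm[OF assms(7)]) auto
    then show ?thesis using f by (simp add: A_space_def hajlasz_space_def)
  qed
  moreover have "A_seminorm \<mu> E ini ter p f \<le> ennreal C * hajlasz_seminorm \<mu> \<alpha> p f"
    if f: "f \<in> hajlasz_space \<mu> \<alpha> p" for f
  proof -
    have "A_seminorm \<mu> E ini ter p f / ennreal C \<le> hajlasz_seminorm \<mu> \<alpha> p f"
      unfolding hajlasz_seminorm_def using norm[OF f] C
      by (intro INF_greatest divide_le_posI_ennreal) auto
    then have "ennreal C * (A_seminorm \<mu> E ini ter p f / ennreal C)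
        \<le> ennreal C * hajlasz_seminorm \<mu> \<alpha> p f"
      by (rule mult_left_mono) simp
    also have "ennreal C * (A_seminorm \<mu> E ini ter p f / ennreal C) = A_seminorm \<mu> E ini ter p f"
      using C mult_divide_eq_ennreal[of "ennreal C"]
      by (simp add: ennreal_times_divide mult.commute[of "ennreal C"])
    finally show ?thesis .
  qed
  ultimately show ?thesis using C by (intro conjI exI[of _ C]) auto
qed

end
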